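(* The map $\alpha$, which sends a simple walk (of length at least $1$) to its corresponding marked increment array, is a bijection between the set of simple walks of (arbitrary) length $n\ge1$ and the set of valid marked arrays.
   Context: Intervals $[a,b]$ are intervals of integers. A simple walk of length $n$ is a function $w:[0,n]\to\mathbb Z$, $w(0)=0$, with increments $w(i)-w(i-1)=\pm1$. The level of the $j$-th increment of $w$ is $w(j-1)-\min_{0\le i<n}w(i)$. The preterminal level of $w$ is $\mathcal P_w=w(n-1)-\min_{i<n}w(i)$ and the maximum level is $\mathcal L_w=\max_{j<n}w(j)-\min_{i<n}w(i)$. An increment array is a collection $\mathbf x=(\underline x_i)_{i=0}^{\mathcal L}$ ($\mathcal L\ge0$) of non-empty finite sequences ("rows") with entries in $\{+1,-1\}$. It corresponds to a walk $w$ of length $n\ge1$ if $\mathcal L_w=\mathcal L$ and for every $i\in[0,\mathcal L]$ the sequence of increments of $w$ at level $i$, in order of time, equals $\underline x_i$. A marked array is a pair $(\mathbf x,\mathcal P)$ with $\mathcal P\in[0,\mathcal L]$; it corresponds to $w$ if $\mathbf x$ corresponds to $w$ and $\mathcal P=\mathcal P_w$. $\alpha(w)$ is the marked array corresponding to $w$. For an array, $u_i$ and $d_i$ are the numbers of entries $+1$ and $-1$ in $\underline x_i$, and $\sigma_{\mathbf x}=\sum_{i=0}^{\mathcal L}(u_i-d_i)$. For a marked array set $\mathcal T=\mathcal P+x^*_{\mathcal P}$, where $x^*_{\mathcal P}$ is the final entry of $\underline x_{\mathcal P}$, and $\mathcal S=\mathcal T-\sigma_{\mathbf x}$. Bookends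 property: for every $i\in[0,\mathcal L]$ with $i\le\min\{\mathcal P,\mathcal T\}$ the final entry of $\underline x_i$ is $1$, and for every $i\in[0,\mathcal L]$ with $i\ge\max\{\mathcal P,\mathcal T\}$ the final entry of $\underline x_i$ is $-1$. Crossings property: for each $i\in[0,\mathcal L+1]$, $u_{i-1}-d_i=\mathbf 1\{i\le\mathcal T\}-\mathbf 1\{i\le\mathcal S\}$, where $u_{-1}=d_{\mathcal L+1}=0$. A marked array is valid if it has both the Bookends and Crossings properties. *)

theory Defs
  imports Main "HOL-Library.FuncSet"
begin

text \<open>
  A walk on the integer interval from 0 to n is a function that is undefined outside
  \<^term>\<open>{0..n}\<close>, so that it carries no information beyond its values there. The set of walks
  of positive length consists of pairs of a length and such a function.
\<close>

definition simple_walk :: "nat \<Rightarrow> (nat \<Rightarrow> int) \<Rightarrow> bool" where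
  "simple_walk n w \<longleftrightarrow>
     w \<in> {0..n} \<rightarrow>\<^sub>E UNIV \<and> w 0 = 0 \<and> (\<forall>i\<in>{1..n}. w i - w (i - 1) \<in> {1, -1})"

definition simple_walks :: "(nat \<times> (nat \<Rightarrow> int)) set" where
  "simple_walks = {(n, w). n \<ge> 1 \<and> simple_walk n w}"

definition walk_min :: "nat \<Rightarrow> (nat \<Rightarrow> int) \<Rightarrow> int" where
  "walk_min n w = Min (w ` {0..<n})"

definition increment_level :: "nat \<Rightarrow> (nat \<Rightarrow> int) \<Rightarrow> nat \<Rightarrow> int" where
  "increment_level n w j = w (j - 1) - walk_min n w"

definition preterminal_level :: "nat \<Rightarrow> (nat \<Rightarrow> int) \<Rightarrow> int" where
  "preterminal_level n w = w (n - 1) - walk_min n w"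

definition max_level :: "nat \<Rightarrow> (nat \<Rightarrow> int) \<Rightarrow> int" where
  "max_level n w = Max (w ` {0..<n}) - walk_min n w"

definition increments_at_level :: "nat \<Rightarrow> (nat \<Rightarrow> int) \<Rightarrow> int \<Rightarrow> int list" where
  "increments_at_level n w i =
     map (\<lambda>j. w j - w (j - 1)) (filter (\<lambda>j. increment_level n w j = i) [1..<Suc n])"

text \<open>
  An array is the list of its rows. Row indices are integers, because the quantities compared
  with them may lie outside the range of indices (for instance be negative).
\<close>

type_synonym int_array = "int list list"

definition top_row :: "int_array \<Rightarrow> int" where
  "top_row x = int (length x) - 1"

definition row :: "int_array \<Rightarrow> int \<Rightarrow> int list" where
  "row x i = x ! nat i"

definition increment_array :: "int_array \<Rightarrow> bool" where
  "increment_array x \<longleftrightarrow>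
     top_row x \<ge> 0 \<and> (\<forall>i\<in>{0..top_row x}. row x i \<noteq> [] \<and> set (row x i) \<subseteq> {1, -1})"

definition marked_array :: "int_array \<times> int \<Rightarrow> bool" where
  "marked_array = (\<lambda>(x, P). increment_array x \<and> P \<in> {0..top_row x})"

definition array_corresponds :: "int_array \<Rightarrow> nat \<times> (nat \<Rightarrow> int) \<Rightarrow> bool" where
  "array_corresponds x = (\<lambda>(n, w).
     max_level n w = top_row x \<and> (\<forall>i\<in>{0..top_row x}. increments_at_level n w i = row x i))"

definition marked_array_corresponds :: "int_array \<times> int \<Rightarrow> nat \<times> (nat \<Rightarrow> int) \<Rightarrow> bool" where
  "marked_array_corresponds = (\<lambda>(x, P) (n, w).
     array_corresponds x (n, w) \<and> P = preterminal_level n w)"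

definition alpha :: "nat \<times> (nat \<Rightarrow> int) \<Rightarrow> int_array \<times> int" where
  "alpha W = (THE m. marked_array m \<and> marked_array_corresponds m W)"

text \<open>The counts vanish at indices that are not rows, in particular at -1 and above the top row.\<close>

definition up_count :: "int_array \<Rightarrow> int \<Rightarrow> int" where
  "up_count x i = (if i \<in> {0..top_row x} then int (count_list (row x i) 1) else 0)"

definition down_count :: "int_array \<Rightarrow> int \<Rightarrow> int" where
  "down_count x i = (if i \<in> {0..top_row x} then int (count_list (row x i) (-1)) else 0)"

definition array_sum :: "int_array \<Rightarrow> int" where
  "array_sum x = (\<Sum>i\<in>{0..top_row x}. up_count x i - down_count x i)"

definition terminal_level :: "int_array \<times> int \<Rightarrow> int" where
  "terminal_level = (\<lambda>(x, P). P + last (row x P))"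

definition start_level :: "int_array \<times> int \<Rightarrow> int" where
  "start_level = (\<lambda>(x, P). terminal_level (x, P) - array_sum x)"

definition bookends :: "int_array \<times> int \<Rightarrow> bool" where
  "bookends = (\<lambda>(x, P). \<forall>i\<in>{0..top_row x}.
     (i \<le> min P (terminal_level (x, P)) \<longrightarrow> last (row x i) = 1) \<and>
     (i \<ge> max P (terminal_level (x, P)) \<longrightarrow> last (row x i) = -1))"

definition crossings :: "int_array \<times> int \<Rightarrow> bool" where
  "crossings = (\<lambda>(x, P). \<forall>i\<in>{0..top_row x + 1}.
     up_count x (i - 1) - down_count x i =
       of_bool (i \<le> terminal_level (x, P)) - of_bool (i \<le> start_level (x, P)))"

definition valid_marked_arrays :: "(int_array \<times> int) set" where
  "valid_marked_arrays = {m. marked_array m \<and> bookends m \<and> crossings m}"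

lemma level_visited:
  assumes w: "simple_walk n w" and n: "n \<ge> 1" and i: "i \<in> {0..max_level n w}"
  shows "\<exists>j\<in>{1..n}. increment_level n w j = i"
proof -
  have fin: "finite (w ` {0..<n})" "w ` {0..<n} \<noteq> {}" using n by auto
  obtain a where a: "a < n" "w a = walk_min n w"
    using Min_in[OF fin] unfolding walk_min_def by auto
  obtain b where b: "b < n" "w b = walk_min n w + max_level n w"
    using Max_in[OF fin] unfolding max_level_def by auto
  have step: "\<bar>w (Suc k) - w k\<bar> \<le> 1" if "k < n" for k
  proof -
    have "w (Suc k) - w (Suc k - 1) \<in> {1, -1}"
      using w that unfolding simple_walk_def by (metis Suc_leI atLeastAtMost_iff le_add1 plus_1_eq_Suc)
    then show ?thesis by auto
  qed
  have "\<exists>k<n. w k = walk_min n w + i"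
  proof (cases "a \<le> b")
    case True
    have "\<exists>k\<ge>a. k \<le> b \<and> w k = walk_min n w + i"
      using nat_intermed_int_val[of a b w "walk_min n w + i"] True step a b i by auto
    then show ?thesis using b(1) le_less_trans by blast
  next
    case False
    have "\<exists>k\<ge>b. k \<le> a \<and> - w k = - (walk_min n w + i)"
    proof (rule nat_intermed_int_val)
      have "\<bar>- w (Suc k) - - w k\<bar> \<le> 1" if "k < a" for k
        using step[of k] that a(1) by linarith
      then show "\<forall>k. b \<le> k \<and> k < a \<longrightarrow> \<bar>- w (Suc k) - - w k\<bar> \<le> 1" by blast
    qed (use False a b i in auto)
    then show ?thesis using a(1) le_less_trans by (metis neg_equal_iff_equal)
  qed
  then obtain k where "k < n" "w k = walk_min n w + i" by auto
  then show ?thesis by (intro bexI[of _ "Suc k"]) (auto simp: increment_level_def)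
qed

lemma alpha_well_defined:
  assumes "W \<in> simple_walks"
  shows "\<exists>!m. marked_array m \<and> marked_array_corresponds m W"
proof -
  obtain n w where W: "W = (n, w)" and n: "n \<ge> 1" and w: "simple_walk n w"
    using assms by (auto simp: simple_walks_def)
  have fin: "finite (w ` {0..<n})" by simp
  have last_in: "w (n - 1) \<in> w ` {0..<n}" using n by auto
  have pre: "preterminal_level n w \<in> {0..max_level n w}"
    using Min_le[OF fin last_in] Max_ge[OF fin last_in]
    unfolding preterminal_level_def max_level_def walk_min_def by auto
  define x where "x = map (\<lambda>k. increments_at_level n w (int k)) [0..<Suc (nat (max_level n w))]"
  have top: "top_row x = max_level n w" using pre by (auto simp: x_def top_row_def)
  have row: "row x i = increments_at_level n w i" if "i \<in> {0..max_level n w}" for i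
  proof -
    have "nat i < Suc (nat (max_level n w))" using that by auto
    then show ?thesis using that by (simp add: row_def x_def del: upt_Suc)
  qed
  have "increments_at_level n w i \<noteq> []" if i: "i \<in> {0..max_level n w}" for i
  proof -
    obtain j where "j \<in> {1..n}" "increment_level n w j = i"
      using level_visited[OF w n i] by blast
    then show ?thesis unfolding increments_at_level_def
      by (auto simp: filter_empty_conv simp del: upt_Suc)
  qed
  moreover have "set (increments_at_level n w i) \<subseteq> {1, -1}" for i
    using w unfolding increments_at_level_def simple_walk_def by (auto simp del: upt_Suc)
  ultimately have "marked_array (x, preterminal_level n w)"
    using pre by (auto simp: marked_array_def increment_array_def top row)
  moreover have "marked_array_corresponds (x, preterminal_level n w) W"
    by (auto simp: W marked_array_corresponds_def array_corresponds_def top row)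
  moreover have "m = (x, preterminal_level n w)"
    if m: "marked_array m" "marked_array_corresponds m W" for m
  proof -
    obtain y P where yP: "m = (y, P)" by force
    have y: "top_row y = max_level n w" "\<And>i. i \<in> {0..max_level n w} \<Longrightarrow> row y i = row x i"
      using m by (auto simp: yP W marked_array_corresponds_def array_corresponds_def row)
    have len: "length y = length x" using y(1) top by (simp add: top_row_def)
    have "y = x"
    proof (rule nth_equalityI[OF len])
      fix k assume "k < length y"
      then have "int k \<in> {0..max_level n w}" using y(1) by (auto simp: top_row_def)
      from y(2)[OF this] show "y ! k = x ! k" by (simp add: row_def)
    qed
    then show ?thesis using m by (simp add: yP W marked_array_corresponds_def)
  qed
  ultimately show ?thesis by blast
qed

end

theory Submission
  imports Defs
begin

text \<open>
  A marked array is read as a collection of stacks of instructions: at level \<open>i\<close>, the walker removes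
  and executes the first remaining entry of row \<open>i\<close>. Together with the starting level \<open>\<S>\<close>, which
  the marked array determines, this recovers the walk, hence injectivity. For surjectivity, remove
  the final entry of row \<open>\<P>\<close> and execute the remaining instructions from \<open>\<S>\<close>. The Crossings property,
  with \<open>\<P>\<close> in place of \<open>\<T>\<close>, is preserved by every step, and it forces the walker to be at \<open>\<P>\<close> when
  it gets stuck. A row left non-empty below \<open>\<P>\<close> still ends in \<open>1\<close> by the Bookends property, so the
  Crossings property makes the next row up non-empty too, and so on up to row \<open>\<P>\<close>, which is
  exhausted; likewise from above. Hence all rows are used up, and the removed entry leads from \<open>\<P>\<close>
  to \<open>\<T>\<close>.
\<close>

section \<open>Increments by level\<close>

text \<open>A form of \<open>increments_at_level\<close> suited to induction: steps carry the time
  at which they start, and levels are not shifted by a minimum.\<close>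

definition exits :: "(nat \<Rightarrow> int) \<Rightarrow> nat \<Rightarrow> int \<Rightarrow> int list" where
  "exits v n i = map (\<lambda>j. v (Suc j) - v j) (filter (\<lambda>j. v j = i) [0..<n])"

definition unit_steps :: "(nat \<Rightarrow> int) \<Rightarrow> nat \<Rightarrow> bool" where
  "unit_steps v n \<longleftrightarrow> (\<forall>j<n. v (Suc j) - v j \<in> {1, -1})"

text \<open>The Crossings equations at every integer: the net number of upward crossings of the edge
  between \<open>i - 1\<close> and \<open>i\<close> on a path from \<open>s\<close> to
  \<open>t\<close>.\<close>

definition flow :: "(int \<Rightarrow> int list) \<Rightarrow> int \<Rightarrow> int \<Rightarrow> bool" where
  "flow R s t \<longleftrightarrow> (\<forall>i. int (count_list (R (i - 1)) 1) - int (count_list (R i) (-1)) =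
     of_bool (i \<le> t) - of_bool (i \<le> s))"

text \<open>Bookends relative to a single level: last exits point towards \<open>t\<close>, while
  row \<open>t\<close> itself is left free.\<close>

definition final_exits :: "(int \<Rightarrow> int list) \<Rightarrow> int \<Rightarrow> bool" where
  "final_exits R t \<longleftrightarrow>
     (\<forall>i. R i \<noteq> [] \<longrightarrow> (i < t \<longrightarrow> last (R i) = 1) \<and> (i > t \<longrightarrow> last (R i) = -1))"

lemma exits_0 [simp]: "exits v 0 i = []"
  by (simp add: exits_def)

lemma exits_Suc:
  "exits v (Suc n) i = exits v n i @ (if v n = i then [v (Suc n) - v n] else [])"
  by (simp add: exits_def)

lemma exits_Suc_front:
  "exits v (Suc n) i = (if v 0 = i then [v 1 - v 0] else []) @ exits (\<lambda>j. v (Suc j)) n i"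
proof -
  have "[0..<Suc n] = 0 # map Suc [0..<n]"
    by (simp add: map_Suc_upt upt_conv_Cons del: upt_Suc)
  then show ?thesis
    by (simp add: exits_def filter_map o_def del: upt_Suc)
qed

lemma exits_cong:
  assumes "\<And>j. j \<le> n \<Longrightarrow> v j = v' j"
  shows "exits v n i = exits v' n i"
  using assms by (induction n) (auto simp: exits_Suc)

lemma exits_eq_Nil_iff: "exits v n i = [] \<longleftrightarrow> i \<notin> v ` {0..<n}"
  by (auto simp: exits_def filter_empty_conv)

lemma unit_steps_Suc:
  "unit_steps v (Suc n) \<longleftrightarrow> unit_steps v n \<and> v (Suc n) - v n \<in> {1, -1}"
  by (auto simp: unit_steps_def less_Suc_eq)

text \<open>Each new step crosses one edge, and moving the endpoint across it changes the indicator
  of \<open>i \<le> t\<close> at exactly that edge.\<close>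

lemma flow_exits:
  assumes "unit_steps v n"
  shows "flow (exits v n) (v 0) (v n)"
  using assms
proof (induction n)
  case 0
  then show ?case by (simp add: flow_def)
next
  case (Suc n)
  have IH: "flow (exits v n) (v 0) (v n)" and st: "v (Suc n) = v n + 1 \<or> v (Suc n) = v n - 1"
    using Suc by (auto simp: unit_steps_Suc)
  show ?case unfolding flow_def
  proof
    fix i
    show "int (count_list (exits v (Suc n) (i - 1)) 1) - int (count_list (exits v (Suc n) i) (-1)) =
      of_bool (i \<le> v (Suc n)) - of_bool (i \<le> v 0)"
      using IH[unfolded flow_def, rule_format, of i] st by (auto simp: exits_Suc)
  qed
qed

text \<open>A walk cannot change sides of a level without revisiting it, so its last exit from the
  level goes to the side where it ends.\<close>

lemma final_exits_exits:
  assumes "unit_steps v n"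
  shows "final_exits (exits v n) (v n)"
  using assms
proof (induction n)
  case 0
  then show ?case by (simp add: final_exits_def)
next
  case (Suc n)
  then have IH: "final_exits (exits v n) (v n)"
    and st: "v (Suc n) = v n + 1 \<or> v (Suc n) = v n - 1"
    by (auto simp: unit_steps_Suc)
  show ?case unfolding final_exits_def
  proof
    fix i
    show "exits v (Suc n) i \<noteq> [] \<longrightarrow> (i < v (Suc n) \<longrightarrow> last (exits v (Suc n) i) = 1) \<and>
      (i > v (Suc n) \<longrightarrow> last (exits v (Suc n) i) = -1)"
      using IH[unfolded final_exits_def, rule_format, of i] st by (auto simp: exits_Suc)
  qed
qed

text \<open>The first step is the head of row \<open>v 0\<close>; deleting it leaves the rows of the
  walk from time 1 on.\<close>

lemma exits_inject:
  assumes "v 0 = v' 0" and "\<And>i. exits v n i = exits v' n' i"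
  shows "n = n' \<and> (\<forall>j\<le>n. v j = v' j)"
  using assms
proof (induction n arbitrary: v v' n')
  case 0
  have "n' = 0"
  proof (rule ccontr)
    assume "n' \<noteq> 0"
    then have "exits v' n' (v' 0) \<noteq> []" by (auto simp: exits_eq_Nil_iff)
    then show False using 0(2)[of "v' 0"] by simp
  qed
  then show ?case using 0 by simp
next
  case (Suc n)
  have "exits v (Suc n) (v 0) \<noteq> []" by (auto simp: exits_eq_Nil_iff)
  then obtain k where k: "n' = Suc k"
    using Suc.prems(2)[of "v 0"] by (cases n') auto
  have eq: "(if v 0 = i then [v 1 - v 0] else []) @ exits (\<lambda>j. v (Suc j)) n i =
      (if v 0 = i then [v' 1 - v 0] else []) @ exits (\<lambda>j. v' (Suc j)) k i" for i
    using Suc.prems(2)[of i] Suc.prems(1) by (simp only: k exits_Suc_front)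
  have one: "v 1 = v' 1" using eq[of "v 0"] by simp
  have "exits (\<lambda>j. v (Suc j)) n i = exits (\<lambda>j. v' (Suc j)) k i" for i
    using eq[of i] one by simp
  then have IH: "n = k \<and> (\<forall>j\<le>n. v (Suc j) = v' (Suc j))"
    using Suc.IH[of "\<lambda>j. v (Suc j)" "\<lambda>j. v' (Suc j)" k] one by simp
  show ?case
  proof (intro conjI allI impI)
    show "Suc n = n'" using IH k by simp
    fix j assume "j \<le> Suc n"
    then show "v j = v' j" using IH Suc.prems(1) by (cases j) auto
  qed
qed

section \<open>Walks with prescribed increments\<close>

text \<open>No entry leaves \<open>s\<close>, so the equation at \<open>s\<close> bounds its
  right-hand side below by 0, which excludes \<open>t < s\<close>, and the one at
  \<open>s + 1\<close> bounds it above by 0, which excludes \<open>t > s\<close>.\<close>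

lemma flow_empty_row:
  assumes "flow R s t" and "R s = []"
  shows "s = t"
proof -
  have "int (count_list (R (s - 1)) 1) - 0 = of_bool (s \<le> t) - of_bool (s \<le> s)"
    using assms(1)[unfolded flow_def, rule_format, of s] assms(2) by simp
  moreover have "0 - int (count_list (R (s + 1)) (-1)) = of_bool (s + 1 \<le> t) - of_bool (s + 1 \<le> s)"
    using assms(1)[unfolded flow_def, rule_format, of "s + 1"] assms(2) by simp
  ultimately show ?thesis by (auto simp: of_bool_def split: if_splits)
qed

text \<open>Emptiness spreads outward from \<open>t\<close>: by balance an empty row leaves no
  \<open>1\<close> in the row below it, but below \<open>t\<close> a non-empty row would end in
  \<open>1\<close>. Above \<open>t\<close> the signs are exchanged.\<close>

lemma balanced_flow_empty:
  assumes fl: "flow R t t" and fe: "final_exits R t" and t: "R t = []"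
  shows "R i = []"
proof -
  have bal: "count_list (R (j - 1)) 1 = count_list (R j) (-1)" for j
    using fl[unfolded flow_def, rule_format, of j] by simp
  have down: "R (t - int k) = []" for k
  proof (induction k)
    case 0
    then show ?case using t by simp
  next
    case (Suc k)
    have "count_list (R (t - int (Suc k))) 1 = 0"
      using bal[of "t - int k"] Suc by (simp add: algebra_simps)
    then have "1 \<notin> set (R (t - int (Suc k)))" by (simp add: count_list_0_iff)
    then show ?case using fe[unfolded final_exits_def, rule_format, of "t - int (Suc k)"]
      by (metis diff_less_eq last_in_set less_add_same_cancel1 of_nat_0_less_iff zero_less_Suc)
  qed
  have up: "R (t + int k) = []" for k
  proof (induction k)
    case 0
    then show ?case using t by simp
  next
    case (Suc k)
    have "count_list (R (t + int (Suc k))) (-1) = 0"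
      using bal[of "t + int (Suc k)"] Suc by (simp add: algebra_simps)
    then have "-1 \<notin> set (R (t + int (Suc k)))" by (simp add: count_list_0_iff)
    then show ?case using fe[unfolded final_exits_def, rule_format, of "t + int (Suc k)"]
      by (metis less_add_same_cancel1 last_in_set of_nat_0_less_iff zero_less_Suc)
  qed
  show ?thesis
    using down[of "nat (t - i)"] up[of "nat (i - t)"] by (cases "i \<le> t") auto
qed

text \<open>Executing \<open>a\<close> uses up one crossing of the edge between \<open>s\<close> and
  \<open>s + a\<close>; moving the start across that edge compensates for it.\<close>

lemma flow_step:
  assumes "flow R s t" and "R s = a # as" and "a \<in> {1, -1}"
  shows "flow (R(s := as)) (s + a) t"
  unfolding flow_def
proof
  fix i
  show "int (count_list ((R(s := as)) (i - 1)) 1) - int (count_list ((R(s := as)) i) (-1)) =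
      of_bool (i \<le> t) - of_bool (i \<le> s + a)"
    using assms(1)[unfolded flow_def, rule_format, of i] assms(2,3)
    by (auto simp: of_bool_def split: if_splits)
qed

text \<open>The walk is built from its first step on, by induction on the number of remaining
  instructions, a sum over the finite set \<open>A\<close>.\<close>

lemma walk_with_exits:
  assumes "finite A" and "\<And>i. i \<notin> A \<Longrightarrow> R i = []"
    and "\<And>i. set (R i) \<subseteq> {1, -1}" and "flow R s t" and "final_exits R t"
  shows "\<exists>v n. v 0 = s \<and> v n = t \<and> unit_steps v n \<and> exits v n = R"
  using assms(2-)
proof (induction "\<Sum>i\<in>A. length (R i)" arbitrary: R s rule: less_induct)
  case less
  show ?case
  proof (cases "R s")
    case Nil
    have "s = t" using flow_empty_row[OF less.prems(3) Nil] by simp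
    then have "R = (\<lambda>i. [])"
      using balanced_flow_empty less.prems Nil by blast
    then show ?thesis
      using \<open>s = t\<close> by (intro exI[of _ "\<lambda>_. s"] exI[of _ 0]) (auto simp: unit_steps_def)
  next
    case (Cons a as)
    define R' where "R' = R(s := as)"
    have a: "a \<in> {1, -1}" using less.prems(2)[of s] Cons by auto
    have s: "s \<in> A" using less.prems(1) Cons by force
    have "(\<Sum>i\<in>A. length (R' i)) < (\<Sum>i\<in>A. length (R i))"
      using s Cons by (intro sum_strict_mono_ex1 assms(1)) (auto simp: R'_def intro!: bexI[of _ s])
    moreover have "R' i = []" if "i \<notin> A" for i
      using less.prems(1) s that by (auto simp: R'_def)
    moreover have "set (R' i) \<subseteq> {1, -1}" for i
      using less.prems(2)[of i] Cons by (auto simp: R'_def)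
    moreover have "flow R' (s + a) t"
      unfolding R'_def using flow_step less.prems(3) Cons a .
    \<comment> \<open>Instructions are removed from the front, so a row that stays non-empty keeps
      its last entry.\<close>
    moreover have "final_exits R' t"
      unfolding final_exits_def
    proof
      fix i
      show "R' i \<noteq> [] \<longrightarrow> (i < t \<longrightarrow> last (R' i) = 1) \<and> (i > t \<longrightarrow> last (R' i) = -1)"
        using less.prems(4)[unfolded final_exits_def, rule_format, of i] Cons
        by (auto simp: R'_def)
    qed
    ultimately obtain v n where v: "v 0 = s + a" "v n = t" "unit_steps v n" "exits v n = R'"
      using less.hyps by metis
    define v' where "v' = case_nat s v"
    have "exits v' (Suc n) i = R i" for i
      using Cons v by (auto simp: exits_Suc_front v'_def R'_def)
    moreover have "unit_steps v' (Suc n)"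
      using v a by (auto simp: unit_steps_def v'_def split: nat.split)
    ultimately show ?thesis
      using v by (intro exI[of _ v'] exI[of _ "Suc n"]) (auto simp: v'_def)
  qed
qed

section \<open>Marked arrays of walks\<close>

text \<open>The minimum ranges over times before \<open>n\<close>, so the level at time
  \<open>n\<close> may be -1 or \<open>max_level n w + 1\<close>.\<close>

definition levels :: "nat \<Rightarrow> (nat \<Rightarrow> int) \<Rightarrow> nat \<Rightarrow> int" where
  "levels n w j = w j - walk_min n w"

text \<open>Padding with empty rows allows the equations to be stated at all integers.\<close>

definition rows :: "int_array \<Rightarrow> int \<Rightarrow> int list" where
  "rows x i = (if i \<in> {0..top_row x} then row x i else [])"

lemma up_count_rows: "up_count x i = int (count_list (rows x i) 1)"
  by (simp add: up_count_def rows_def)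

lemma down_count_rows: "down_count x i = int (count_list (rows x i) (-1))"
  by (simp add: down_count_def rows_def)

lemma increments_at_level_exits: "increments_at_level n w i = exits (levels n w) n i"
proof -
  have "[1..<Suc n] = map Suc [0..<n]" by (simp add: map_Suc_upt del: upt_Suc)
  then show ?thesis
    by (simp add: increments_at_level_def exits_def levels_def increment_level_def filter_map o_def
        del: upt_Suc)
qed

lemma unit_steps_levels:
  assumes "simple_walk n w"
  shows "unit_steps (levels n w) n"
  unfolding unit_steps_def
proof (intro allI impI)
  fix j assume "j < n"
  then have "Suc j \<in> {1..n}" by simp
  then have "w (Suc j) - w (Suc j - 1) \<in> {1, -1}"
    using assms unfolding simple_walk_def by blast
  then show "levels n w (Suc j) - levels n w j \<in> {1, -1}" by (simp add: levels_def)
qed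

lemma levels_range:
  assumes "j < n"
  shows "levels n w j \<in> {0..max_level n w}"
  using assms by (auto simp: levels_def max_level_def walk_min_def)

section \<open>Net crossings and the array sum\<close>

lemma array_sum_flow:
  assumes "top_row x \<ge> 0"
  shows "array_sum x = (\<Sum>i\<in>{0..top_row x + 1}. up_count x (i - 1) - down_count x i)"
proof -
  let ?L = "top_row x"
  have u: "(\<Sum>i\<in>{0..?L + 1}. up_count x (i - 1)) = (\<Sum>i\<in>{-1..?L}. up_count x i)"
    by (rule sum.reindex_bij_witness[of _ "\<lambda>i. i + 1" "\<lambda>i. i - 1"]) auto
  also have "\<dots> = (\<Sum>i\<in>{0..?L}. up_count x i)"
    by (rule sum.mono_neutral_right) (auto simp: up_count_def)
  finally have u: "(\<Sum>i\<in>{0..?L + 1}. up_count x (i - 1)) = (\<Sum>i\<in>{0..?L}. up_count x i)" .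
  have d: "(\<Sum>i\<in>{0..?L + 1}. down_count x i) = (\<Sum>i\<in>{0..?L}. down_count x i)"
    by (rule sum.mono_neutral_right) (auto simp: down_count_def)
  show ?thesis unfolding array_sum_def sum_subtractf u d ..
qed

lemma sum_of_bool_le:
  assumes "b \<ge> -1"
  shows "(\<Sum>i\<in>{0..b}. of_bool (i \<le> t) :: int) = max 0 (min t b + 1)"
proof -
  have "(\<Sum>i\<in>{0..b}. of_bool (i \<le> t) :: int) = (\<Sum>i\<in>{0..min t b}. 1)"
    by (rule sum.mono_neutral_cong_right) auto
  then show ?thesis by simp
qed

text \<open>The indicators sum to positions clamped to \<open>[-1, top_row x + 1]\<close>, since
  \<open>s\<close> and \<open>t\<close> are not assumed to lie there.\<close>

lemma array_sum_of_crossings: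
  assumes "top_row x \<ge> 0"
    and "\<And>i. i \<in> {0..top_row x + 1} \<Longrightarrow>
      up_count x (i - 1) - down_count x i = of_bool (i \<le> t) - of_bool (i \<le> s)"
  shows "array_sum x =
    max 0 (min t (top_row x + 1) + 1) - max 0 (min s (top_row x + 1) + 1)"
proof -
  have "array_sum x = (\<Sum>i\<in>{0..top_row x + 1}. of_bool (i \<le> t) - of_bool (i \<le> s))"
    unfolding array_sum_flow[OF assms(1)] by (rule sum.cong[OF refl assms(2)])
  also have "\<dots> = (\<Sum>i\<in>{0..top_row x + 1}. of_bool (i \<le> t)) -
      (\<Sum>i\<in>{0..top_row x + 1}. of_bool (i \<le> s))"
    by (rule sum_subtractf)
  finally show ?thesis using assms(1) by (simp only: sum_of_bool_le)
qed

lemma walk_corresponds: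
  assumes w: "simple_walk n w" "n \<ge> 1"
    and m: "marked_array (x, P)" "marked_array_corresponds (x, P) (n, w)"
  shows "exits (levels n w) n = rows x" and "P = levels n w (n - 1)"
    and "terminal_level (x, P) = levels n w n" and "start_level (x, P) = levels n w 0"
    and "flow (rows x) (levels n w 0) (levels n w n)"
proof -
  define v where "v = levels n w"
  have v: "unit_steps v n" using unit_steps_levels[OF w(1)] by (simp add: v_def)
  have top: "max_level n w = top_row x" and "top_row x \<ge> 0"
    using m by (auto simp: marked_array_corresponds_def array_corresponds_def marked_array_def
        increment_array_def)
  have range: "v j \<in> {0..top_row x}" if "j < n" for j
    using levels_range[OF that, of w] by (simp add: v_def top)
  show ex: "exits (levels n w) n = rows x"
  proof
    fix i
    show "exits (levels n w) n i = rows x i"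
    proof (cases "i \<in> {0..top_row x}")
      case True
      then show ?thesis
        using m(2) by (simp add: rows_def marked_array_corresponds_def array_corresponds_def
            increments_at_level_exits)
    next
      case False
      then have "i \<notin> v ` {0..<n}" using range by auto
      then have "exits v n i = []" by (simp add: exits_eq_Nil_iff)
      then show ?thesis using False by (simp only: rows_def v_def if_False)
    qed
  qed
  show P: "P = levels n w (n - 1)"
    using m(2) by (simp add: marked_array_corresponds_def preterminal_level_def levels_def)
  obtain k where k: "n = Suc k" using w(2) by (cases n) auto
  have "P \<in> {0..top_row x}" using m(1) by (simp add: marked_array_def)
  then have "row x P = exits v n P" using ex by (simp add: rows_def v_def fun_eq_iff)
  then have T: "terminal_level (x, P) = v n"
    using P by (simp add: terminal_level_def k exits_Suc v_def)
  then show "terminal_level (x, P) = levels n w n" by (simp add: v_def)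
  show fl: "flow (rows x) (levels n w 0) (levels n w n)"
    using flow_exits[OF v] ex by (simp add: v_def)
  have "array_sum x =
    max 0 (min (v n) (top_row x + 1) + 1) - max 0 (min (v 0) (top_row x + 1) + 1)"
    using fl \<open>top_row x \<ge> 0\<close>
    by (intro array_sum_of_crossings) (auto simp: up_count_rows down_count_rows flow_def v_def)
  \<comment> \<open>The start is in range and the end at most one step outside, so the clamps change
    nothing and \<open>array_sum x\<close> is the displacement.\<close>
  moreover have "v 0 \<in> {0..top_row x}" using range w(2) by simp
  moreover have "v n \<in> {-1..top_row x + 1}"
    using range[of k] v by (auto simp: k unit_steps_Suc)
  ultimately have "array_sum x = v n - v 0" by auto
  then show "start_level (x, P) = levels n w 0"
    using T by (simp add: start_level_def v_def)
qed

lemma alpha_corresponds: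
  assumes "W \<in> simple_walks"
  shows "marked_array (alpha W) \<and> marked_array_corresponds (alpha W) W"
  unfolding alpha_def by (rule theI'[OF alpha_well_defined[OF assms]])

lemma alpha_eqI:
  assumes "W \<in> simple_walks" "marked_array m" "marked_array_corresponds m W"
  shows "alpha W = m"
  unfolding alpha_def
  using alpha_well_defined[OF assms(1)] assms(2,3) by (simp add: the1_equality)

section \<open>Injectivity\<close>

lemma inj_on_alpha: "inj_on alpha simple_walks"
proof (rule inj_onI)
  fix W W' assume W: "W \<in> simple_walks" "W' \<in> simple_walks" and eq: "alpha W = alpha W'"
  obtain n w n' w' where nw: "W = (n, w)" "W' = (n', w')" by (cases W, cases W')
  obtain x P where xP: "alpha W = (x, P)" by force
  note c = walk_corresponds[of n w x P] walk_corresponds[of n' w' x P]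
  have w: "simple_walk n w" "n \<ge> 1" "simple_walk n' w'" "n' \<ge> 1"
    using W by (auto simp: nw simple_walks_def)
  have m: "marked_array (x, P)" "marked_array_corresponds (x, P) (n, w)"
    "marked_array_corresponds (x, P) (n', w')"
    using alpha_corresponds[OF W(1)] alpha_corresponds[OF W(2)] xP eq nw by auto
  \<comment> \<open>Both level paths start at \<open>start_level (x, P)\<close> and have the rows of
    \<open>x\<close>.\<close>
  have "n = n' \<and> (\<forall>j\<le>n. levels n w j = levels n' w' j)"
    using c w m by (intro exits_inject) auto
  then have n: "n = n'" and lev: "\<And>j. j \<le> n \<Longrightarrow> levels n w j = levels n' w' j" by auto
  \<comment> \<open>Both walks vanish at time 0, so equal levels there mean equal minima.\<close>
  have "w j = w' j" if "j \<in> {0..n}" for j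
    using lev[of j] lev[of 0] that w(1,3) by (simp add: levels_def simple_walk_def)
  then have "w = w'"
    using w(1,3) n unfolding simple_walk_def by (metis PiE_ext)
  then show "W = W'" using n nw by simp
qed

section \<open>Validity of the array of a walk\<close>

lemma alpha_valid:
  assumes "W \<in> simple_walks"
  shows "alpha W \<in> valid_marked_arrays"
proof -
  obtain n w where nw: "W = (n, w)" by force
  obtain x P where xP: "alpha W = (x, P)" by force
  have w: "simple_walk n w" "n \<ge> 1" using assms by (auto simp: nw simple_walks_def)
  have m: "marked_array (x, P)" "marked_array_corresponds (x, P) (n, w)"
    using alpha_corresponds[OF assms] xP nw by auto
  note c = walk_corresponds[OF w m]
  define v where "v = levels n w"
  obtain k where k: "n = Suc k" using w(2) by (cases n) auto
  have v: "unit_steps v k" "v n = v k + 1 \<or> v n = v k - 1"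
    using unit_steps_levels[OF w(1)] by (auto simp: v_def k unit_steps_Suc)
  have "crossings (x, P)"
    using c(3-5) by (auto simp: crossings_def up_count_rows down_count_rows flow_def)
  moreover have "bookends (x, P)"
    unfolding bookends_def
  proof (clarsimp simp: c(3), intro conjI impI)
    fix i assume i: "0 \<le> i" "i \<le> top_row x"
    have row: "row x i = exits v k i @ (if v k = i then [v n - v k] else [])"
      using i fun_cong[OF c(1), of i] by (auto simp: rows_def v_def k exits_Suc)
    have P: "P = v k" using c(2) by (simp add: v_def k)
    have "row x i \<noteq> []" using m(1) i by (auto simp: marked_array_def increment_array_def)
    then have nonempty: "exits v k i \<noteq> []" if "i \<noteq> v k" using row that by auto
    \<comment> \<open>This concerns the walk without its last step, which ends at \<open>P\<close>;
      the omitted step is the last entry of row \<open>P\<close> and leads to the terminal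
      level.\<close>
    have fe: "exits v k i \<noteq> [] \<Longrightarrow> (i < v k \<longrightarrow> last (exits v k i) = 1) \<and>
        (i > v k \<longrightarrow> last (exits v k i) = -1)"
      using final_exits_exits[OF v(1)] by (auto simp: final_exits_def)
    {
      assume "i \<le> P \<and> i \<le> levels n w n"
      then show "last (row x i) = 1"
        using row P nonempty fe v(2) by (cases "i = v k") (auto simp: v_def)
    next
      assume "P \<le> i \<and> levels n w n \<le> i"
      then show "last (row x i) = -1"
        using row P nonempty fe v(2) by (cases "i = v k") (auto simp: v_def)
    }
  qed
  ultimately show ?thesis using m(1) by (simp add: valid_marked_arrays_def xP)
qed

section \<open>Surjectivity\<close>

lemma valid_flow:
  assumes "(x, P) \<in> valid_marked_arrays"
  shows "flow (rows x) (start_level (x, P)) (terminal_level (x, P))"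
proof -
  let ?T = "terminal_level (x, P)" and ?S = "start_level (x, P)" and ?L = "top_row x"
  have L: "?L \<ge> 0" and P: "P \<in> {0..?L}" and "set (row x P) \<subseteq> {1, -1}" and "row x P \<noteq> []"
    and cr: "crossings (x, P)"
    using assms by (auto simp: valid_marked_arrays_def marked_array_def increment_array_def)
  then have "last (row x P) \<in> {1, -1}" using last_in_set by blast
  then have T: "?T \<in> {-1..?L + 1}" using P by (auto simp: terminal_level_def)
  have cr': "up_count x (i - 1) - down_count x i = of_bool (i \<le> ?T) - of_bool (i \<le> ?S)"
    if "i \<in> {0..?L + 1}" for i
    using cr that unfolding crossings_def by blast
  have "array_sum x = max 0 (min ?T (?L + 1) + 1) - max 0 (min ?S (?L + 1) + 1)"
    using L cr' by (rule array_sum_of_crossings)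
  moreover have "array_sum x = ?T - ?S" by (simp add: start_level_def)
  \<comment> \<open>The clamp does nothing to \<open>?T\<close>; as the sum is
    \<open>?T - ?S\<close>, it does nothing to \<open>?S\<close> either.\<close>
  ultimately have S: "?S \<in> {-1..?L + 1}" using T by auto
  show ?thesis
    unfolding flow_def
  proof
    fix i
    show "int (count_list (rows x (i - 1)) 1) - int (count_list (rows x i) (-1)) =
        of_bool (i \<le> ?T) - of_bool (i \<le> ?S)"
    proof (cases "i \<in> {0..?L + 1}")
      case True
      then show ?thesis using cr'[of i] by (simp add: up_count_rows down_count_rows)
    next
      case False
      \<comment> \<open>Here both rows are empty and the two indicators agree, since
        \<open>?S\<close> and \<open>?T\<close> lie in \<open>[-1, ?L + 1]\<close>.\<close>
      then show ?thesis using S T by (auto simp: rows_def)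
    qed
  qed
qed

text \<open>Holding back the last entry of row \<open>P\<close> moves the target from the terminal
  level to \<open>P\<close>; appended at the end, it makes \<open>P\<close> the level before the
  last step.\<close>

lemma valid_array_walk:
  assumes "(x, P) \<in> valid_marked_arrays"
  shows "\<exists>v k. unit_steps v (Suc k) \<and> v k = P \<and> exits v (Suc k) = rows x"
proof -
  let ?T = "terminal_level (x, P)" and ?S = "start_level (x, P)" and ?L = "top_row x"
  have P: "P \<in> {0..?L}" and be: "bookends (x, P)"
    and row: "\<And>i. i \<in> {0..?L} \<Longrightarrow> row x i \<noteq> [] \<and> set (row x i) \<subseteq> {1, -1}"
    using assms by (auto simp: valid_marked_arrays_def marked_array_def increment_array_def)
  define a where "a = last (row x P)"
  define R where "R = (rows x)(P := butlast (row x P))"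
  have T: "?T = P + a" by (simp add: terminal_level_def a_def)
  have rowP: "rows x P = R P @ [a]"
    using row[OF P] P by (simp add: rows_def R_def a_def)
  have a: "a = 1 \<or> a = -1" using row[OF P] last_in_set[of "row x P"] unfolding a_def by blast
  have rest: "rows x i = R i" if "i \<noteq> P" for i using that by (simp add: R_def)
  have "R i = []" if "i \<notin> {0..?L}" for i
    using that P by (auto simp: R_def rows_def)
  moreover have "set (rows x i) \<subseteq> {1, -1}" for i using row[of i] by (auto simp: rows_def)
  then have "set (R i) \<subseteq> {1, -1}" for i
    using rest[of i] rowP by (cases "i = P") (metis Un_subset_iff set_append, metis)
  moreover have "flow R ?S P"
    unfolding flow_def
  proof
    fix i
    have fl: "int (count_list (rows x (i - 1)) 1) - int (count_list (rows x i) (-1)) =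
        of_bool (i \<le> P + a) - of_bool (i \<le> ?S)"
      using valid_flow[OF assms] unfolding flow_def T by blast
    consider "i = P" | "i = P + 1" | "i \<noteq> P" "i \<noteq> P + 1" by blast
    then show "int (count_list (R (i - 1)) 1) - int (count_list (R i) (-1)) =
        of_bool (i \<le> P) - of_bool (i \<le> ?S)"
      using fl a by cases (auto simp: rowP rest)
  qed
  moreover have "final_exits R P"
    unfolding final_exits_def
  proof (intro allI impI)
    fix i assume ne: "R i \<noteq> []"
    have range: "i \<in> {0..?L}" using ne P by (auto simp: R_def rows_def split: if_splits)
    then have "(i \<le> min P (P + a) \<longrightarrow> last (row x i) = 1) \<and>
        (i \<ge> max P (P + a) \<longrightarrow> last (row x i) = -1)"
      using be unfolding bookends_def T[symmetric] by blast
    moreover have "i \<noteq> P \<Longrightarrow> R i = row x i" using range by (simp add: R_def rows_def)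
    \<comment> \<open>As \<open>a\<close> is 1 or -1, \<open>i < P\<close> gives
      \<open>i \<le> min P (P + a)\<close> and \<open>i > P\<close> gives
      \<open>i \<ge> max P (P + a)\<close>.\<close>
    ultimately show "(i < P \<longrightarrow> last (R i) = 1) \<and> (i > P \<longrightarrow> last (R i) = -1)"
      using a by auto
  qed
  ultimately obtain v k where v: "v k = P" "unit_steps v k" "exits v k = R"
    using walk_with_exits[of "{0..?L}" R ?S P] by auto
  define v' where "v' = v(Suc k := P + a)"
  have "exits v' k = R" using exits_cong[of k v' v] v(3) by (auto simp: v'_def)
  then have "exits v' (Suc k) i = rows x i" for i
    using v(1) rowP rest[of i] by (auto simp: exits_Suc v'_def)
  moreover have "unit_steps v' (Suc k)"
    using v(1,2) a by (auto simp: unit_steps_def v'_def less_Suc_eq)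
  moreover have "v' k = P" using v(1) by (simp add: v'_def)
  ultimately show ?thesis by blast
qed

lemma alpha_surj:
  assumes "m \<in> valid_marked_arrays"
  shows "m \<in> alpha ` simple_walks"
proof -
  obtain x P where xP: "m = (x, P)" by force
  have m: "marked_array (x, P)" using assms by (simp add: xP valid_marked_arrays_def)
  then have L: "top_row x \<ge> 0" and row: "\<And>i. i \<in> {0..top_row x} \<Longrightarrow> row x i \<noteq> []"
    by (auto simp: marked_array_def increment_array_def)
  obtain v k where v: "unit_steps v (Suc k)" "v k = P" "exits v (Suc k) = rows x"
    using valid_array_walk assms xP by blast
  define n where "n = Suc k"
  \<comment> \<open>The path is translated to start at 0 and made undefined after time
    \<open>n\<close>, as \<open>simple_walk\<close> demands.\<close>
  define w where "w = restrict (\<lambda>j. v j - v 0) {0..n}"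
  \<comment> \<open>The levels visited before time \<open>n\<close> are those with a non-empty row,
    hence all of \<open>{0..top_row x}\<close>; so \<open>v\<close> has minimum 0 there and
    \<open>levels n w\<close> gives back \<open>v\<close>.\<close>
  have "v ` {0..<n} = {i. rows x i \<noteq> []}"
    using exits_eq_Nil_iff[of v n] v(3) by (auto simp: n_def)
  also have "\<dots> = {0..top_row x}" using row by (auto simp: rows_def)
  finally have img: "v ` {0..<n} = {0..top_row x}" .
  have "w ` {0..<n} = (\<lambda>i. i - v 0) ` (v ` {0..<n})"
    by (auto simp: w_def image_image)
  also have "\<dots> = {- v 0..top_row x - v 0}"
    unfolding img using image_add_atLeastAtMost'[of "- v 0"] by simp
  finally have wimg: "w ` {0..<n} = {- v 0..top_row x - v 0}" .
  have min: "walk_min n w = - v 0"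
    unfolding walk_min_def wimg using L by (intro Min_eqI) auto
  have "Max {- v 0..top_row x - v 0} = top_row x - v 0"
    using L by (intro Max_eqI) auto
  then have max: "max_level n w = top_row x"
    unfolding max_level_def wimg min by simp
  have lev: "levels n w j = v j" if "j \<le> n" for j
    using that unfolding levels_def min by (simp add: w_def)
  have "w i - w (i - 1) \<in> {1, -1}" if "i \<in> {1..n}" for i
    using v(1)[unfolded unit_steps_def, rule_format, of "i - 1"] that
    by (auto simp: w_def n_def)
  then have W: "(n, w) \<in> simple_walks"
    by (auto simp: simple_walks_def simple_walk_def w_def n_def)
  have "increments_at_level n w i = row x i" if "i \<in> {0..top_row x}" for i
    using exits_cong[of n "levels n w" v] lev v(3) that
    by (simp add: increments_at_level_exits n_def rows_def)
  moreover have "preterminal_level n w = P"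
    using lev[of k] v(2) by (simp add: preterminal_level_def levels_def n_def)
  ultimately have "marked_array_corresponds (x, P) (n, w)"
    by (simp add: marked_array_corresponds_def array_corresponds_def max)
  then show ?thesis using alpha_eqI[OF W m] W xP by force
qed

theorem theorem4p7:
  "bij_betw alpha simple_walks valid_marked_arrays"
  unfolding bij_betw_def using inj_on_alpha alpha_valid alpha_surj by blast

end
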